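(* Let $d_1<d_2<\cdots$ be the elements of $D$ and $u_1<u_2<\cdots$ the elements of $U$ in increasing order. Then \[\{d_{k+1}-d_k:k\ge1\}=\{u_{k+1}-u_k:k\ge1\}=\{1,2,3,5\}.\]
   Context: $\phi=(1+\sqrt5)/2$. For positive integers $a_1,a_2$, the $(a_1,a_2)$-Fibonacci walk is $w_k=w_k(a_1,a_2)$ with $w_1=a_1$, $w_2=a_2$, $w_{k+2}=w_{k+1}+w_k$. Let $s(n;a_1,a_2)$ be the integer $s$ with $w_s(a_1,a_2)=n$ ($-\infty$ if none), and $s(n)=\max_{a_1,a_2\ge1}s(n;a_1,a_2)$. A pair $(a_1,a_2)$ is $n$-good if $a_1,a_2\ge1$ and $s(n;a_1,a_2)=s(n)$; its walk is then an $n$-slow Fibonacci walk. An integer $n\ge2$ is in $D$ (down-integer) if $w_{s(n)+1}=\lfloor\phi n\rfloor$ for some $n$-slow walk, and in $U$ (up-integer) if $w_{s(n)+1}=\lceil\phi n\rceil$ for some $n$-slow walk. *)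

theory Defs
  imports Complex_Main "HOL-Library.Infinite_Set"
begin

definition golden :: real where
  "golden = (1 + sqrt 5) / 2"

text \<open>Walks are indexed from 1, so that \<open>fib_walk a b 1 = a\<close> and \<open>fib_walk a b 2 = b\<close>;
  the value at index 0 is a dummy, and every use below requires the index to be positive.\<close>

fun fib_walk :: "nat \<Rightarrow> nat \<Rightarrow> nat \<Rightarrow> nat" where
  "fib_walk a b 0 = 0"
| "fib_walk a b (Suc 0) = a"
| "fib_walk a b (Suc (Suc 0)) = b"
| "fib_walk a b (Suc (Suc (Suc k))) = fib_walk a b (Suc (Suc k)) + fib_walk a b (Suc k)"

text \<open>For positive \<open>a\<close>, \<open>b\<close> the index at which the walk takes the value \<open>n\<close> is unique, except
  when \<open>a = b = n\<close>, where it is 1 or 2 and the larger is taken. Since genuine indices are at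
  least 1, the value 0 plays the role of minus infinity for walks that never hit \<open>n\<close>.\<close>

definition walk_index :: "nat \<Rightarrow> nat \<Rightarrow> nat \<Rightarrow> nat" where
  "walk_index n a b =
     (if \<exists>s\<ge>1. fib_walk a b s = n
      then GREATEST s. s \<ge> 1 \<and> fib_walk a b s = n
      else 0)"

text \<open>There are infinitely many pairs but only finitely many values, because a walk from positive
  integers is strictly increasing from its second term on; so \<open>Max\<close> is the true maximum.\<close>

definition slow_length :: "nat \<Rightarrow> nat" where
  "slow_length n = Max {walk_index n a b | a b. a \<ge> 1 \<and> b \<ge> 1}"

definition good_pair :: "nat \<Rightarrow> nat \<Rightarrow> nat \<Rightarrow> bool" where
  "good_pair n a b \<longleftrightarrow> a \<ge> 1 \<and> b \<ge> 1 \<and> walk_index n a b = slow_length n"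

definition down_integers :: "nat set" where
  "down_integers =
     {n. n \<ge> 2 \<and> (\<exists>a b. good_pair n a b \<and>
        int (fib_walk a b (slow_length n + 1)) = \<lfloor>golden * real n\<rfloor>)}"

definition up_integers :: "nat set" where
  "up_integers =
     {n. n \<ge> 2 \<and> (\<exists>a b. good_pair n a b \<and>
        int (fib_walk a b (slow_length n + 1)) = \<lceil>golden * real n\<rceil>)}"

text \<open>\<open>enumerate\<close> counts from 0, the sequences here from 1. It lists a set in increasing order
  only if the set is infinite.\<close>

definition down_seq :: "nat \<Rightarrow> nat" where
  "down_seq k = enumerate down_integers (k - 1)"

definition up_seq :: "nat \<Rightarrow> nat" where
  "up_seq k = enumerate up_integers (k - 1)"

end

theory Submission
  imports Defs "HOL-Number_Theory.Fib"
begin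

text \<open>
  A walk of length \<open>j + 2\<close> from positive integers ends in \<open>n\<close> and continues with \<open>m\<close> iff
  \<open>m / n\<close> lies strictly between the consecutive convergents \<open>fib (j + 1) / fib j\<close> and
  \<open>fib (j + 2) / fib (j + 1)\<close> of \<open>golden\<close>. Hence only the floor and the ceiling of \<open>golden * n\<close>
  matter, the floor being constrained by odd indices \<open>i\<close> and the ceiling by even ones, in the
  form \<open>offset i n < n * slope i\<close>, where \<open>slope i = \<bar>fib (i + 1) / fib i - golden\<bar>\<close>. So \<open>n\<close> is a
  down-integer (up-integer) iff the inequality holds for some odd (even) \<open>i\<close> but not for \<open>i + 1\<close>.

  Stepping from \<open>n\<close> to \<open>n + k\<close> rotates the fractional part of \<open>golden * n\<close> by \<open>golden * k\<close>, while the
  thresholds barely move. If \<open>n\<close> and \<open>n + 4\<close> are down-integers then, according to whether the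
  fractional part at \<open>n\<close> is at least \<open>(golden - 1) ^ 4\<close>, lowering it by \<open>(golden - 1) ^ 4\<close> shows that
  \<open>n + 3\<close> is one, or lowering that of \<open>n + 4\<close> by \<open>(golden - 1) ^ 3\<close> shows that \<open>n + 2\<close> is one; this
  excludes the gap 4. Five consecutive points of the rotation leave no arc longer than
  \<open>(golden - 1) ^ 3\<close>, and a fractional part of at most this always suffices for large \<open>n\<close>, so gaps
  are at most 5. Up-integers are treated in the same way with time reversed.
\<close>

section \<open>The golden ratio and Fibonacci numbers\<close>

lemma golden_square: "golden * golden = golden + 1"
  by (simp add: golden_def field_simps)

lemma golden_bounds: "809 / 500 < golden" "golden < 16181 / 10000"
proof -
  have "559 / 250 < sqrt 5"
    by (rule real_less_rsqrt) (simp add: power2_eq_square)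
  moreover have "sqrt 5 < 11181 / 5000"
    by (rule real_less_lsqrt) (auto simp: power2_eq_square)
  ultimately show "809 / 500 < golden" "golden < 16181 / 10000"
    by (simp_all add: golden_def)
qed

text \<open>\<open>1 - golden\<close> is the conjugate root of x^2 = x + 1; this Binet-type identity
  measures how well Fibonacci quotients approximate \<open>golden\<close>.\<close>

lemma real_fib_Suc: "real (fib (Suc j)) = golden * fib j + (1 - golden) ^ j"
proof (induction j)
  case (Suc j)
  have "golden * real (fib (Suc j)) = (golden * golden) * fib j + golden * (1 - golden) ^ j"
    unfolding Suc.IH by (simp add: algebra_simps)
  then show ?case
    using Suc.IH by (simp add: golden_square algebra_simps)
qed simp

section \<open>Backward terms and approximation of \<open>golden\<close>\<close>

text \<open>For positive \<open>n\<close>, the distance from \<open>golden * n\<close> to its floor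
  (odd \<open>i\<close>) or ceiling (even \<open>i\<close>).\<close>

definition offset :: "nat \<Rightarrow> nat \<Rightarrow> real" where
  "offset i n = (if odd i then frac (golden * n) else 1 - frac (golden * n))"

text \<open>For \<open>i \<ge> 1\<close> this says that a fraction with denominator \<open>n\<close> lies between \<open>golden\<close>
  and the convergent \<open>fib (i + 1) / fib i\<close>, which is below \<open>golden\<close> exactly for odd \<open>i\<close>.\<close>

definition near :: "nat \<Rightarrow> nat \<Rightarrow> bool" where
  "near n i \<longleftrightarrow> offset i n * fib i < n * (golden - 1) ^ i"

text \<open>The term \<open>i\<close> steps before \<open>n\<close> in the walk that continues with \<open>m\<close> after \<open>n\<close>.\<close>

definition prior :: "nat \<Rightarrow> int \<Rightarrow> nat \<Rightarrow> int" where
  "prior n m i = (-1) ^ i * (int n * fib (i + 1) - m * fib i)"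

text \<open>Substituting \<open>real_fib_Suc\<close> for \<open>fib (i + 1)\<close> separates a
  decaying main term from the error of \<open>m\<close> against \<open>golden * n\<close>, whose
  sign alternates.\<close>

lemma real_prior:
  "real_of_int (prior n m i) = n * (golden - 1) ^ i - (-1) ^ i * (m - golden * n) * fib i"
proof -
  have "(-1) ^ i * (1 - golden) ^ i = (golden - 1) ^ i"
    by (simp flip: power_mult_distrib)
  then have *: "(golden - 1) ^ i = (-1) ^ i * (1 - golden) ^ i" ..
  show ?thesis
    unfolding prior_def * by (simp add: real_fib_Suc algebra_simps del: fib.simps)
qed

text \<open>Descent: if \<open>golden * n\<close> were an integer \<open>m\<close>, the integer
  \<open>prior n m i\<close> would lie strictly between 0 and 1 for large \<open>i\<close>.\<close>

lemma golden_mult_notin_Ints: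
  assumes "n \<ge> 1"
  shows "golden * real n \<notin> \<int>"
proof
  assume "golden * real n \<in> \<int>"
  then obtain m where m: "golden * real n = real_of_int m"
    by (auto elim: Ints_cases)
  obtain i where i: "(golden - 1) ^ i < 1 / real n"
    using real_arch_pow_inv[of "1 / real n" "golden - 1"] golden_bounds assms by auto
  have "real_of_int (prior n m i) = n * (golden - 1) ^ i"
    by (simp add: real_prior m)
  moreover have "0 < n * (golden - 1) ^ i" "n * (golden - 1) ^ i < 1"
    using golden_bounds assms i by (simp_all add: field_simps)
  ultimately have "0 < real_of_int (prior n m i)" "real_of_int (prior n m i) < 1"
    by simp_all
  then show False
    by simp
qed

lemma frac_golden:
  assumes "n \<ge> 1"
  shows "0 < frac (golden * real n)" "frac (golden * real n) < 1"
  using golden_mult_notin_Ints[OF assms] by (simp_all add: frac_lt_1)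

lemma offset_pos: "n \<ge> 1 \<Longrightarrow> 0 < offset i n"
  using frac_golden[of n] by (auto simp: offset_def)

lemma offset_Suc: "offset (Suc i) n = 1 - offset i n"
  by (simp add: offset_def)

lemma ceiling_golden:
  assumes "n \<ge> 1"
  shows "\<lceil>golden * real n\<rceil> = \<lfloor>golden * real n\<rfloor> + 1"
  using golden_mult_notin_Ints[OF assms] by (simp add: ceiling_altdef) (metis Ints_of_int)

text \<open>\<open>offset\<close> depends only on the parity of the index, while \<open>fib\<close>
  is monotone and the powers of \<open>golden - 1\<close> decrease.\<close>

lemma near_antimono:
  assumes "n \<ge> 1" "i \<le> k" "even i = even k" "near n k"
  shows "near n i"
proof -
  have "offset i n * fib i \<le> offset i n * fib k"
    using offset_pos[OF assms(1), of i] fib_mono[OF assms(2)] by (intro mult_left_mono) auto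
  also have "offset i n * fib k < n * (golden - 1) ^ k"
    using assms(3,4) by (simp add: near_def offset_def)
  also have "n * (golden - 1) ^ k \<le> n * (golden - 1) ^ i"
    using golden_bounds assms(2) by (intro mult_left_mono power_decreasing) auto
  finally show ?thesis
    by (simp add: near_def)
qed

text \<open>For these signs of \<open>m - golden * n\<close> the error in \<open>real_prior\<close>
  contributes nonnegatively to a positive main term.\<close>

lemma prior_pos_parity:
  assumes "n \<ge> 1"
  shows "odd i \<Longrightarrow> m > \<lfloor>golden * n\<rfloor> \<Longrightarrow> prior n m i > 0"
    and "even i \<Longrightarrow> m \<le> \<lfloor>golden * n\<rfloor> \<Longrightarrow> prior n m i > 0"
proof -
  have 0: "0 < n * (golden - 1) ^ i"
    using golden_bounds assms by simp
  have "real_of_int (prior n m i) > 0" if "odd i" "m > \<lfloor>golden * n\<rfloor>"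
  proof -
    have "real_of_int m - golden * n \<ge> 0"
      using that(2) by linarith
    then have "(real_of_int m - golden * n) * fib i \<ge> 0"
      by simp
    then show ?thesis
      using 0 that(1) unfolding real_prior by (simp add: algebra_simps)
  qed
  then show "odd i \<Longrightarrow> m > \<lfloor>golden * n\<rfloor> \<Longrightarrow> prior n m i > 0"
    by simp
  have "real_of_int (prior n m i) > 0" if "even i" "m \<le> \<lfloor>golden * n\<rfloor>"
  proof -
    have "real_of_int m - golden * n \<le> 0"
      using that(2) by linarith
    then have "(real_of_int m - golden * n) * fib i \<le> 0"
      by (simp add: mult_nonpos_nonneg)
    then show ?thesis
      using 0 that(1) unfolding real_prior by simp
  qed
  then show "even i \<Longrightarrow> m \<le> \<lfloor>golden * n\<rfloor> \<Longrightarrow> prior n m i > 0"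
    by simp
qed

text \<open>At these two values of \<open>m\<close> the error in \<open>real_prior\<close> has size
  \<open>offset i n * fib i\<close>. A real inequality thus becomes a computable integer
  one.\<close>

lemma near_iff_prior:
  "near n i \<longleftrightarrow> prior n (if odd i then \<lfloor>golden * n\<rfloor> else \<lfloor>golden * n\<rfloor> + 1) i > 0" (is "_ \<longleftrightarrow> ?b > 0")
proof -
  have "near n i \<longleftrightarrow> real_of_int ?b > 0"
    unfolding real_prior by (auto simp: near_def offset_def frac_def algebra_simps)
  then show ?thesis
    by simp
qed

text \<open>Moving \<open>m\<close> up to the floor (odd \<open>i\<close>) or down to the integer
  above it (even \<open>i\<close>) never lowers \<open>prior\<close>.\<close>

lemma near_if_prior:
  assumes "prior n m i > 0" "odd i = (m \<le> \<lfloor>golden * n\<rfloor>)"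
  shows "near n i"
proof (cases "odd i")
  case True
  then have "m * fib i \<le> \<lfloor>golden * n\<rfloor> * fib i"
    using assms(2) by (simp add: mult_right_mono)
  then show ?thesis
    using assms(1) True by (simp add: near_iff_prior prior_def)
next
  case False
  then have "(\<lfloor>golden * n\<rfloor> + 1) * fib i \<le> m * fib i"
    using assms(2) by (intro mult_right_mono) auto
  then show ?thesis
    using assms(1) False by (simp add: near_iff_prior prior_def)
qed

section \<open>Walks described by their backward terms\<close>

lemma fib_walk_fib: "fib_walk a b (j + 2) = a * fib j + b * fib (j + 1)"
  by (induction j rule: fib.induct) (simp_all add: algebra_simps)

text \<open>The two vectors \<open>(a, b)\<close> and \<open>(n, m)\<close> determine each other because the Fibonacci
  matrix relating them is unimodular (Cassini).\<close>

lemma walk_iff_prior: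
  "(\<exists>a\<ge>1. \<exists>b\<ge>1. fib_walk a b (j + 2) = n \<and> int (fib_walk a b (j + 3)) = m) \<longleftrightarrow>
   prior n m j > 0 \<and> prior n m (j + 1) > 0" (is "?L \<longleftrightarrow> ?R")
proof -
  define f g where "f = int (fib j)" and "g = int (fib (j + 1))"
  have f2: "int (fib (j + 2)) = f + g"
    by (simp add: f_def g_def)
  have sq: "(-1) ^ j * ((-1) ^ j * x) = x" for x :: int
    by (simp flip: mult.assoc power_mult_distrib)
  have cas: "g * g - (f + g) * f = (-1) ^ j"
    using fib_Cassini_int[of j] by (simp add: f_def g_def power2_eq_square algebra_simps)
  have prior: "prior n m j = (-1) ^ j * (int n * g - m * f)"
    "prior n m (j + 1) = (-1) ^ j * (m * g - int n * (f + g))"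
    by (simp_all add: prior_def f_def g_def algebra_simps)
  have walk: "int (fib_walk a b (j + 2)) = int a * f + int b * g"
    "int (fib_walk a b (j + 3)) = int a * g + int b * (f + g)" for a b
    using fib_walk_fib[of a b j] fib_walk_fib[of a b "j + 1"]
    by (simp_all add: f_def g_def add.commute numeral_3_eq_3)
  show ?thesis
  proof
    assume ?L
    then obtain a b where ab: "a \<ge> 1" "b \<ge> 1" "int n = int a * f + int b * g"
        "m = int a * g + int b * (f + g)"
      using walk by metis
    have "int n * g - m * f = (g * g - (f + g) * f) * int b"
      "m * g - int n * (f + g) = (g * g - (f + g) * f) * int a"
      unfolding ab by algebra+
    then have "prior n m j = int b" "prior n m (j + 1) = int a"
      unfolding prior cas by (simp_all add: sq)
    then show ?R
      using ab by simp
  next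
    assume R: ?R
    define a b where "a = nat (prior n m (j + 1))" and "b = nat (prior n m j)"
    have ab: "a \<ge> 1" "b \<ge> 1" "int a = prior n m (j + 1)" "int b = prior n m j"
      using R by (auto simp: a_def b_def)
    have "int a * f + int b * g = (-1) ^ j * ((g * g - (f + g) * f) * int n)"
      "int a * g + int b * (f + g) = (-1) ^ j * ((g * g - (f + g) * f) * m)"
      unfolding ab prior by algebra+
    then have "int (fib_walk a b (j + 2)) = int n" "int (fib_walk a b (j + 3)) = m"
      unfolding walk cas by (simp_all add: sq)
    then show ?L
      using ab by auto
  qed
qed

section \<open>Longest walks and membership by parity\<close>

text \<open>Position 1 is left out at no cost: the choice \<open>b = n\<close> puts a positive
  \<open>n\<close> at position 2.\<close>

definition reachable :: "nat \<Rightarrow> nat \<Rightarrow> bool" where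
  "reachable n j \<longleftrightarrow> (\<exists>a\<ge>1. \<exists>b\<ge>1. fib_walk a b (j + 2) = n)"

text \<open>Of the two conditions in \<open>walk_iff_prior\<close>, one holds by
  \<open>prior_pos_parity\<close>; the other, at the index of the remaining parity, is
  \<open>near\<close>.\<close>

lemma walk_next_floor_or_ceiling:
  assumes "n \<ge> 1"
  shows "(\<exists>a\<ge>1. \<exists>b\<ge>1. fib_walk a b (j + 2) = n \<and> int (fib_walk a b (j + 3)) = \<lfloor>golden * n\<rfloor>) \<longleftrightarrow>
      near n (if odd j then j else j + 1)"
    and "(\<exists>a\<ge>1. \<exists>b\<ge>1. fib_walk a b (j + 2) = n \<and> int (fib_walk a b (j + 3)) = \<lceil>golden * n\<rceil>) \<longleftrightarrow>
      near n (if even j then j else j + 1)"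
  using prior_pos_parity[OF assms]
  unfolding walk_iff_prior ceiling_golden[OF assms] by (auto simp: near_iff_prior)

text \<open>Whatever the next term \<open>m\<close>, exactly one of \<open>j\<close> and
  \<open>j + 1\<close> has the parity to which \<open>near_if_prior\<close> applies. Conversely, the
  floor or the ceiling serves as \<open>m\<close>.\<close>

lemma reachable_iff_near:
  assumes "n \<ge> 1"
  shows "reachable n j \<longleftrightarrow> near n j \<or> near n (j + 1)"
proof
  assume "reachable n j"
  then obtain m where m: "prior n m j > 0" "prior n m (j + 1) > 0"
    unfolding reachable_def by (metis walk_iff_prior)
  then show "near n j \<or> near n (j + 1)"
    using near_if_prior by (cases "odd j = (m \<le> \<lfloor>golden * n\<rfloor>)") (blast, auto)
next
  assume "near n j \<or> near n (j + 1)"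
  then show "reachable n j"
    using walk_next_floor_or_ceiling[OF assms, of j] unfolding reachable_def
    by (cases "odd j") auto
qed

lemma less_fib: "j < fib (j + 2)"
  by (induction j rule: fib.induct) auto

text \<open>A crude bound, which ensures that a longest walk exists.\<close>

lemma reachable_imp_le:
  assumes "reachable n j"
  shows "j \<le> n"
proof -
  obtain a b where ab: "a \<ge> 1" "b \<ge> 1" "n = a * fib j + b * fib (j + 1)"
    using assms unfolding reachable_def fib_walk_fib by blast
  have "1 * fib j + 1 * fib (j + 1) \<le> n"
    unfolding ab(3) using ab(1,2) by (intro add_mono mult_right_mono) auto
  then show ?thesis
    using less_fib[of j] by simp
qed

lemma walk_index_bound:
  assumes "a \<ge> 1" "b \<ge> 1" and last: "\<forall>k. reachable n k \<longrightarrow> k \<le> j"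
  shows "walk_index n a b \<le> j + 2"
    and "walk_index n a b = j + 2 \<longleftrightarrow> fib_walk a b (j + 2) = n"
proof -
  let ?P = "\<lambda>s. s \<ge> 1 \<and> fib_walk a b s = n"
  have bound: "s \<le> j + 2" if "?P s" for s
  proof (cases "s \<ge> 2")
    case True
    then have "reachable n (s - 2)"
      unfolding reachable_def le_add_diff_inverse2[OF True] using assms(1,2) that by blast
    then show ?thesis
      using last by force
  qed simp
  \<comment> \<open>\<open>GREATEST\<close> is attained only thanks to the bound just shown.\<close>
  then have g: "?P (Greatest ?P)" if "\<exists>s. ?P s"
    using that GreatestI_ex_nat[of ?P "j + 2"] by blast
  have idx: "walk_index n a b = (if \<exists>s. ?P s then Greatest ?P else 0)"
    by (rule walk_index_def)
  show le: "walk_index n a b \<le> j + 2"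
  proof (cases "\<exists>s. ?P s")
    case True
    show ?thesis
      unfolding idx if_P[OF True] by (rule bound[OF g[OF True]])
  next
    case False
    show ?thesis
      unfolding idx if_not_P[OF False] by simp
  qed
  show "walk_index n a b = j + 2 \<longleftrightarrow> fib_walk a b (j + 2) = n"
  proof
    assume *: "walk_index n a b = j + 2"
    \<comment> \<open>The default value 0 of \<open>walk_index\<close> differs from
      \<open>j + 2\<close>.\<close>
    have True: "\<exists>s. ?P s"
    proof (rule ccontr)
      assume "\<not> (\<exists>s. ?P s)"
      then show False
        using * unfolding idx by (simp only: if_False)
    qed
    show "fib_walk a b (j + 2) = n"
      using g[OF True] unfolding *[symmetric] idx if_P[OF True] by blast
  next
    assume "fib_walk a b (j + 2) = n"
    then have P: "?P (j + 2)"
      by simp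
    then have True: "\<exists>s. ?P s"
      by blast
    have "j + 2 \<le> Greatest ?P"
      using Greatest_le_nat[of ?P, OF P] bound by blast
    then show "walk_index n a b = j + 2"
      using le unfolding idx if_P[OF True] by (rule le_antisym[rotated])
  qed
qed

lemma slow_length_eq:
  assumes "reachable n j" and last: "\<forall>k. reachable n k \<longrightarrow> k \<le> j"
  shows "slow_length n = j + 2"
  unfolding slow_length_def
proof (rule Max_eqI)
  show le: "y \<le> j + 2" if "y \<in> {walk_index n a b |a b. 1 \<le> a \<and> 1 \<le> b}" for y
    using that walk_index_bound(1)[OF _ _ last] by blast
  show "finite {walk_index n a b |a b. 1 \<le> a \<and> 1 \<le> b}"
    by (rule finite_subset[OF _ finite_atMost[of "j + 2"]]) (use le in blast)
  obtain a b where ab: "a \<ge> 1" "b \<ge> 1" "fib_walk a b (j + 2) = n"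
    using assms(1) unfolding reachable_def by blast
  have "j + 2 = walk_index n a b \<and> 1 \<le> a \<and> 1 \<le> b"
    using ab walk_index_bound(2)[OF ab(1,2) last] by simp
  then show "j + 2 \<in> {walk_index n a b |a b. 1 \<le> a \<and> 1 \<le> b}"
    by blast
qed

lemma good_pair_iff:
  assumes "reachable n j" and last: "\<forall>k. reachable n k \<longrightarrow> k \<le> j"
  shows "good_pair n a b \<longleftrightarrow> a \<ge> 1 \<and> b \<ge> 1 \<and> fib_walk a b (j + 2) = n"
  unfolding good_pair_def slow_length_eq[OF assms] using walk_index_bound(2)[OF _ _ last] by blast

text \<open>At the greatest reachable \<open>j\<close>, \<open>near n (j + 1)\<close> would make
  \<open>j + 1\<close> reachable too, so \<open>j\<close> is reachable through
  \<open>near n j\<close>.\<close>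

lemma last_reachable:
  assumes "n \<ge> 1"
  obtains j where "near n j" "\<not> near n (j + 1)" "reachable n j" "\<forall>k. reachable n k \<longrightarrow> k \<le> j"
proof -
  \<comment> \<open>The left side vanishes since \<open>fib 0 = 0\<close>.\<close>
  have "near n 0"
    using assms by (simp add: near_def)
  then have ex: "\<exists>j. reachable n j"
    using reachable_iff_near[OF assms] by blast
  define j where "j = (GREATEST j. reachable n j)"
  have j: "reachable n j"
    using GreatestI_ex_nat[of "reachable n" n] ex reachable_imp_le unfolding j_def by blast
  have last: "k \<le> j" if "reachable n k" for k
    using Greatest_le_nat[of "reachable n" k n] that reachable_imp_le unfolding j_def by blast
  have "\<not> near n (j + 1)"
    using last[of "j + 1"] reachable_iff_near[OF assms, of "j + 1"] by auto
  moreover from this have "near n j"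
    using j reachable_iff_near[OF assms, of j] by blast
  moreover have "\<forall>k. reachable n k \<longrightarrow> k \<le> j"
    using last by blast
  ultimately show ?thesis
    using that j by simp
qed

text \<open>By monotonicity within each parity, every \<open>i\<close> with \<open>near n i\<close> and \<open>\<not> near n (i + 1)\<close>
  has the parity of the last \<open>near\<close> index, so such an \<open>i\<close> need not be the last one.\<close>

lemma down_up_iff_parity:
  assumes "n \<ge> 2" "near n i" "\<not> near n (i + 1)"
  shows "n \<in> down_integers \<longleftrightarrow> odd i" and "n \<in> up_integers \<longleftrightarrow> even i"
proof -
  have n: "n \<ge> 1"
    using assms(1) by simp
  obtain j where j: "near n j" "\<not> near n (j + 1)" "reachable n j" "\<forall>k. reachable n k \<longrightarrow> k \<le> j"
    using last_reachable[OF n] .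
  have "i \<le> j"
    using assms(2) reachable_iff_near[OF n, of i] j(4) by simp
  have parity: "even i = even j"
  proof (rule ccontr)
    assume *: "even i \<noteq> even j"
    then have "i \<noteq> j"
      by blast
    with \<open>i \<le> j\<close> have "i + 1 \<le> j"
      by simp
    with * show False
      using near_antimono[OF n, of "i + 1" j] j(1) assms(3) by simp
  qed
  have j3: "j + 2 + 1 = j + 3"
    by simp
  have "n \<in> down_integers \<longleftrightarrow> near n (if odd j then j else j + 1)"
    unfolding down_integers_def mem_Collect_eq good_pair_iff[OF j(3,4)] slow_length_eq[OF j(3,4)] j3
      walk_next_floor_or_ceiling(1)[OF n, symmetric] using assms(1) by blast
  moreover have "n \<in> up_integers \<longleftrightarrow> near n (if even j then j else j + 1)"
    unfolding up_integers_def mem_Collect_eq good_pair_iff[OF j(3,4)] slow_length_eq[OF j(3,4)] j3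
      walk_next_floor_or_ceiling(2)[OF n, symmetric] using assms(1) by blast
  ultimately show "n \<in> down_integers \<longleftrightarrow> odd i" "n \<in> up_integers \<longleftrightarrow> even i"
    using j(1,2) parity by simp_all
qed

lemma down_up_cases:
  assumes "n \<ge> 2"
  obtains i where "near n i" "\<not> near n (i + 1)"
    "n \<in> down_integers \<longleftrightarrow> odd i" "n \<in> up_integers \<longleftrightarrow> even i"
proof -
  obtain i where i: "near n i" "\<not> near n (i + 1)"
    using last_reachable[of n] assms by auto
  then show ?thesis
    using that[OF i] down_up_iff_parity[OF assms i] by simp
qed

lemma fib_values:
  "fib 3 = 2" "fib 4 = 3" "fib 5 = 5" "fib 6 = 8" "fib 7 = 13" "fib 8 = 21" "fib 9 = 34"
  by (simp_all add: eval_nat_numeral)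

text \<open>A numerical certificate: \<open>m\<close> is the floor of \<open>golden * n\<close>, and
  the last hypothesis is the integer form of \<open>near n i\<close> and
  \<open>\<not> near n (i + 1)\<close>.\<close>

lemma down_up_of_integers:
  fixes m :: int
  assumes "n \<ge> 2" "real_of_int m \<le> golden * n" "golden * n < real_of_int m + 1"
    and "if odd i then int n * fib (i + 1) < m * fib i \<and> (m + 1) * fib (i + 1) \<ge> int n * fib (i + 2)
      else (m + 1) * fib i < int n * fib (i + 1) \<and> int n * fib (i + 2) \<ge> m * fib (i + 1)"
  shows "n \<in> down_integers \<longleftrightarrow> odd i" and "n \<in> up_integers \<longleftrightarrow> even i"
proof -
  have "\<lfloor>golden * n\<rfloor> = m"
    using assms(2,3) by linarith
  then have "near n i" "\<not> near n (i + 1)"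
    using assms(4) unfolding near_iff_prior prior_def
    by (cases "odd i"; simp del: fib.simps add: add.assoc)+
  then show "n \<in> down_integers \<longleftrightarrow> odd i" "n \<in> up_integers \<longleftrightarrow> even i"
    using down_up_iff_parity[OF assms(1)] by auto
qed

section \<open>Thresholds and rotation of the fractional part\<close>

definition slope :: "nat \<Rightarrow> real" where
  "slope i = (golden - 1) ^ i / fib i"

lemma slope_pos: "i \<ge> 1 \<Longrightarrow> slope i > 0"
  using golden_bounds fib_neq_0_nat[of i] by (simp add: slope_def)

lemma slope_antimono:
  assumes "1 \<le> i" "i \<le> k"
  shows "slope k \<le> slope i"
  unfolding slope_def using golden_bounds fib_mono[OF assms(2)] fib_neq_0_nat[of i] assms
  by (intro frac_le power_decreasing zero_le_power) auto

lemma golden_powers: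
  "(golden - 1) ^ 2 = 2 - golden" "(golden - 1) ^ 3 = 2 * golden - 3"
  "(golden - 1) ^ 4 = 5 - 3 * golden" "(golden - 1) ^ 5 = 5 * golden - 8"
  using golden_square by algebra+

lemma slope_numeral:
  "slope 3 = (2 * golden - 3) / 2" "slope 4 = (5 - 3 * golden) / 3" "slope 5 = (5 * golden - 8) / 5"
  unfolding slope_def golden_powers by (simp_all add: eval_nat_numeral)

definition turn :: "nat \<Rightarrow> nat \<Rightarrow> bool" where
  "turn n i \<longleftrightarrow> near n i \<and> \<not> near n (i + 1)"

lemma turn_iff:
  assumes "i \<ge> 1"
  shows "turn n i \<longleftrightarrow> offset i n < n * slope i \<and> n * slope (i + 1) \<le> 1 - offset i n"
proof -
  have "fib i > 0" "fib (Suc i) > 0"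
    using fib_neq_0_nat assms by auto
  then show ?thesis
    by (auto simp: turn_def near_def slope_def offset_Suc field_simps not_less simp del: fib.simps power_Suc)
qed

text \<open>Lowering the offset by \<open>d\<close> gains \<open>d\<close> in both inequalities of
  \<open>turn_iff\<close>; the last two hypotheses say that the moving thresholds cost no
  more.\<close>

lemma turn_shift:
  assumes "i \<ge> 1" "turn n i" "offset i n' = offset i n - d"
    and "(real n' - real n) * slope (i + 1) \<le> d" "(real n - real n') * slope i \<le> d"
  shows "turn n' i"
  using assms unfolding turn_iff[OF assms(1)] left_diff_distrib by linarith

text \<open>The increment \<open>k\<close> is real and so may be negative, which covers steps
  backwards; \<open>m\<close> is the integer lost in the rotation.\<close>

lemma frac_golden_shift:
  fixes m :: int
  assumes "real n' = real n + k" 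
    and "0 \<le> frac (golden * n) + (golden * k - m)" "frac (golden * n) + (golden * k - m) < 1"
  shows "frac (golden * n') = frac (golden * n) + (golden * k - m)"
  unfolding frac_unique_iff
proof (intro conjI)
  have "golden * n' - (frac (golden * n) + (golden * k - m)) = of_int (\<lfloor>golden * n\<rfloor> + m)"
    by (simp add: assms(1) frac_def algebra_simps)
  then show "golden * n' - (frac (golden * n) + (golden * k - m)) \<in> \<int>"
    by (metis Ints_of_int)
qed (use assms(2,3) in auto)

lemma turn_down_up:
  assumes "n \<ge> 2" "turn n i"
  shows "n \<in> down_integers \<longleftrightarrow> odd i" and "n \<in> up_integers \<longleftrightarrow> even i"
  using down_up_iff_parity[OF assms(1)] assms(2) by (auto simp: turn_def)

text \<open>The index 1 would need \<open>n * (2 - golden) \<le> 1\<close>, which fails from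
  \<open>n = 3\<close> on. Larger indices have slopes small enough for
  \<open>turn_shift\<close>.\<close>

lemma down_turn:
  assumes "n \<in> down_integers" "n \<ge> 3"
  obtains i where "turn n i" "odd i" "i \<ge> 3"
proof -
  obtain i where i: "turn n i" "odd i"
    using assms down_up_cases[of n] unfolding turn_def by auto
  have "i \<noteq> 1"
  proof
    assume "i = 1"
    then have "\<not> near n 2"
      using i(1) by (simp add: turn_def numeral_2_eq_2)
    then have "n * (2 - golden) \<le> 1 - frac (golden * n)"
      by (simp add: near_def offset_def golden_powers not_less)
    moreover have "3 * (2 - golden) \<le> n * (2 - golden)"
      using assms(2) golden_bounds by (intro mult_right_mono) auto
    moreover have "1 - frac (golden * n) \<le> 1"
      by simp
    ultimately have "3 * (2 - golden) \<le> 1"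
      by (meson order_trans)
    then show False
      using golden_bounds by simp
  qed
  with i(2) have "i \<ge> 3"
    by (cases "i = 2") (auto elim!: oddE)
  with that i show ?thesis
    by blast
qed

lemma up_turn:
  assumes "n \<in> up_integers" "n \<ge> 2"
  obtains i where "turn n i" "even i" "i \<ge> 2" "n \<ge> 9 \<Longrightarrow> i \<ge> 4"
proof -
  obtain i where i: "turn n i" "even i"
    using assms down_up_cases[of n] unfolding turn_def by auto
  have t: "frac (golden * n) < 1"
    using frac_lt_1 .
  have "i \<noteq> 0"
  proof
    assume "i = 0"
    then have "n * (golden - 1) \<le> frac (golden * n)"
      using i(1) by (simp add: turn_def near_def offset_def not_less)
    moreover have "2 * (golden - 1) \<le> n * (golden - 1)"
      using assms(2) golden_bounds by (intro mult_right_mono) auto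
    ultimately show False
      using t golden_bounds by simp
  qed
  moreover have "i \<noteq> 2" if "n \<ge> 9"
  proof
    assume "i = 2"
    then have "\<not> near n 3"
      using i(1) by (simp add: turn_def)
    then have "n * (2 * golden - 3) \<le> frac (golden * n) * 2"
      by (simp add: near_def offset_def golden_powers not_less fib_values)
    \<comment> \<open>9 is the least multiplier for which the product exceeds 2.\<close>
    moreover have "9 * (2 * golden - 3) \<le> n * (2 * golden - 3)"
      using that golden_bounds by (intro mult_right_mono) auto
    ultimately show False
      using t golden_bounds by simp
  qed
  ultimately have "i \<ge> 2" "n \<ge> 9 \<Longrightarrow> i \<ge> 4"
    using i(2) by (auto elim!: evenE)
  with that i show ?thesis
    by blast
qed

section \<open>Exclusion of the gap 4\<close>

lemma no_gap_4_down:
  assumes "n \<in> down_integers" "n + 4 \<in> down_integers"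
  shows "n + 1 \<in> down_integers \<or> n + 2 \<in> down_integers \<or> n + 3 \<in> down_integers"
proof (cases "n \<ge> 3")
  case False
  then have "n = 2"
    using assms(1) by (simp add: down_integers_def)
  moreover have "5 \<in> down_integers"
    using down_up_of_integers(1)[of 5 8 3] golden_bounds by (simp add: fib_values)
  ultimately show ?thesis
    by simp
next
  case True
  define t where "t = frac (golden * n)"
  have t: "0 < t" "t < 1"
    using frac_golden[of n] True by (simp_all add: t_def)
  show ?thesis
  proof (cases "t \<ge> 5 - 3 * golden")
    case True
    obtain i where i: "turn n i" "odd i" "i \<ge> 3"
      using down_turn assms(1) \<open>n \<ge> 3\<close> by blast
    \<comment> \<open>Three steps raise the threshold by at most \<open>3 * slope 4\<close>, which
      is exactly the drop \<open>d = 5 - 3 * golden\<close>.\<close>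
    have "slope (i + 1) \<le> slope 4" "slope i > 0"
      using i(3) by (auto intro!: slope_antimono slope_pos)
    moreover have "frac (golden * real (n + 3)) = t + (golden * 3 - of_int 5)"
      unfolding t_def using True t golden_bounds by (intro frac_golden_shift) (auto simp: t_def)
    ultimately have "turn (n + 3) i"
      using i golden_bounds by (intro turn_shift[OF _ i(1), where d = "5 - 3 * golden"])
        (auto simp: offset_def t_def slope_numeral)
    then show ?thesis
      using turn_down_up(1) i(2) by auto
  next
    case False
    obtain i where i: "turn (n + 4) i" "odd i" "i \<ge> 3"
      using down_turn[OF assms(2)] by auto
    \<comment> \<open>Two steps back lower the threshold by at most \<open>2 * slope 3\<close>,
      again exactly the drop \<open>d = 2 * golden - 3\<close>.\<close>
    have "slope i \<le> slope 3" "slope (i + 1) > 0"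
      using i(3) by (auto intro!: slope_antimono slope_pos)
    moreover have "frac (golden * real (n + 2)) = t + (golden * 2 - of_int 3)"
      "frac (golden * real (n + 4)) = t + (golden * 4 - of_int 6)"
      unfolding t_def using False t golden_bounds by (intro frac_golden_shift; auto simp: t_def)+
    ultimately have "turn (n + 2) i"
      using i golden_bounds by (intro turn_shift[OF _ i(1), where d = "2 * golden - 3"])
        (auto simp: offset_def slope_numeral)
    then show ?thesis
      using turn_down_up(1) i(2) by auto
  qed
qed

lemma no_gap_4_up:
  assumes "n \<in> up_integers" "n + 4 \<in> up_integers"
  shows "n + 1 \<in> up_integers \<or> n + 2 \<in> up_integers \<or> n + 3 \<in> up_integers"
proof (cases "n \<ge> 5")
  \<comment> \<open>Here \<open>n + 4 < 9\<close>, so \<open>up_turn\<close> does not give the index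
    bound 4 at \<open>n + 4\<close>; these \<open>n\<close> are settled by explicit members.\<close>
  case False
  then have "n = 2 \<or> n = 3 \<or> n = 4"
    using assms(1) by (auto simp: up_integers_def)
  moreover have "3 \<in> up_integers" "4 \<in> up_integers" "6 \<in> up_integers"
    using down_up_of_integers(2)[of 3 4 2] down_up_of_integers(2)[of 4 6 2]
      down_up_of_integers(2)[of 6 9 2] golden_bounds by (simp_all add: fib_values)
  ultimately show ?thesis
    by auto
next
  case True
  define t where "t = frac (golden * real (n + 4))"
  have t: "0 < t" "t < 1"
    using frac_golden[of "n + 4"] by (simp_all add: t_def)
  show ?thesis
  proof (cases "1 - t > 5 - 3 * golden")
    case c: True
    obtain i where i: "turn (n + 4) i" "even i" "i \<ge> 4"
    proof -
      have "n + 4 \<ge> 2" "n + 4 \<ge> 9"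
        using True by simp_all
      then show ?thesis
        using up_turn[OF assms(2)] that by blast
    qed
    have "slope i \<le> slope 4" "slope (i + 1) > 0"
      using i(3) by (auto intro!: slope_antimono slope_pos)
    moreover have "frac (golden * real (n + 1)) = t + (golden * (- 3) - of_int (- 5))"
      unfolding t_def using c t golden_bounds by (intro frac_golden_shift) (auto simp: t_def)
    ultimately have "turn (n + 1) i"
      using i golden_bounds by (intro turn_shift[OF _ i(1), where d = "5 - 3 * golden"])
        (auto simp: offset_def t_def slope_numeral)
    then show ?thesis
      using turn_down_up(2)[of "n + 1" i] i(2) True by auto
  next
    case False
    obtain i where i: "turn n i" "even i" "i \<ge> 2"
      using up_turn[OF assms(1)] True by auto
    have "slope (i + 1) \<le> slope 3" "slope i > 0"
      using i(3) by (auto intro!: slope_antimono slope_pos)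
    moreover have "frac (golden * real (n + 2)) = t + (golden * (- 2) - of_int (- 3))"
      "frac (golden * real n) = t + (golden * (- 4) - of_int (- 6))"
      unfolding t_def using False t golden_bounds by (intro frac_golden_shift; auto simp: t_def)+
    ultimately have "turn (n + 2) i"
      using i golden_bounds by (intro turn_shift[OF _ i(1), where d = "2 * golden - 3"])
        (auto simp: offset_def slope_numeral)
    then show ?thesis
      using turn_down_up(2)[of "n + 2" i] i(2) by auto
  qed
qed

section \<open>Gaps are at most 5\<close>

text \<open>Consecutive slopes have ratio \<open>(golden - 1) * fib (i + 1) / fib (i + 2)\<close>,
  and the Fibonacci quotient is at least 3/5.\<close>

lemma slope_at_next:
  assumes "i \<ge> 3" "real N * slope (i + 2) \<le> 2 * golden - 3"
  shows "real N * slope (i + 1) \<le> 5 / 3 * (2 - golden)"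
proof -
  define p q where "p = real (fib (i + 1))" and "q = real (fib (i + 2))"
  obtain k where k: "i = k + 1"
    using assms(1) by (metis add.commute le_add_diff_inverse numeral_le_iff one_le_numeral order_trans)
  \<comment> \<open>In terms of \<open>fib i\<close> and \<open>fib k\<close>, the bound
    \<open>q * 3 \<le> p * 5\<close> below amounts to \<open>fib i \<le> 2 * fib k\<close>.\<close>
  have "fib (i + 2) = fib (i + 1) + fib i" "fib (i + 1) = fib i + fib k" "fib i \<le> 2 * fib k" "fib (i + 2) > 0" "fib (i + 1) > 0"
    using fib_neq_0_nat[of "i + 1"] fib_neq_0_nat[of "i + 2"] fib_mono[of "k - 1" k] k assms(1) by (auto simp: eval_nat_numeral dest!: Suc_le_D)
  then have pq: "q * 3 \<le> p * 5" "p > 0" "q > 0"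
    unfolding p_def q_def by (linarith, simp_all only: of_nat_0_less_iff)
  have "slope (i + 2) = (golden - 1) * slope (i + 1) * (p / q)"
    using pq by (simp add: slope_def p_def q_def)
  then have "real N * slope (i + 2) = (golden - 1) * (real N * slope (i + 1)) * (p / q)"
    by (simp only: ac_simps)
  then have "(golden - 1) * (real N * slope (i + 1)) * (p / q) \<le> 2 * golden - 3"
    using assms(2) by simp
  also have "2 * golden - 3 = (golden - 1) * (2 - golden)"
    using golden_square by algebra
  finally have "(golden - 1) * (real N * slope (i + 1) * (p / q)) \<le> (golden - 1) * (2 - golden)"
    by (simp add: mult.assoc)
  then have "real N * slope (i + 1) * (p / q) \<le> 2 - golden"
    by (rule mult_left_le_imp_le) (use golden_bounds in simp)
  then have "real N * slope (i + 1) \<le> (2 - golden) * (q / p)"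
    using pq by (simp add: field_simps)
  also have "\<dots> \<le> (2 - golden) * (5 / 3)"
    using pq golden_bounds by (intro mult_left_mono) (auto simp: field_simps)
  finally show ?thesis
    by simp
qed

lemma slope_le_power:
  assumes "i \<ge> 1"
  shows "slope i \<le> (golden - 1) ^ i"
  using golden_bounds fib_neq_0_nat[of i] assms
  by (simp add: slope_def divide_le_eq mult_le_cancel_left1)

text \<open>The largest admissible \<open>i\<close> of the given parity works for all five numbers at once.\<close>

lemma turn_window:
  assumes "k \<ge> 4" "real N * slope k > 2 * golden - 3"
  obtains i where "even i = even k" "\<And>n. N \<le> n \<Longrightarrow> n \<le> N + 4 \<Longrightarrow> offset k n \<le> 2 * golden - 3 \<Longrightarrow> turn n i"
proof -
  let ?Q = "\<lambda>m. real N * slope (k + 2 * m) > 2 * golden - 3"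
  have "N > 0"
    using assms(2) golden_bounds by (intro Nat.gr0I) auto
  obtain m where m: "(golden - 1) ^ m < (2 * golden - 3) / N"
    using real_arch_pow_inv[of "(2 * golden - 3) / N" "golden - 1"] golden_bounds \<open>N > 0\<close> by auto
  have "slope (k + 2 * m) \<le> (golden - 1) ^ (k + 2 * m)"
    using assms(1) by (intro slope_le_power) auto
  also have "\<dots> \<le> (golden - 1) ^ m"
    using golden_bounds by (intro power_decreasing) auto
  finally have "slope (k + 2 * m) < (2 * golden - 3) / N"
    using m by linarith
  then have "\<not> ?Q m"
    using \<open>N > 0\<close> by (simp add: field_simps)
  moreover have "?Q 0"
    using assms(2) by simp
  ultimately obtain l where l: "?Q l" "\<not> ?Q (Suc l)"
    using dec_induct[of 0 m ?Q] by auto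
  define i where "i = k + 2 * l"
  have i: "i \<ge> 4" "real N * slope i > 2 * golden - 3" "real N * slope (i + 2) \<le> 2 * golden - 3"
    using l assms(1) by (simp_all add: i_def)
  have "turn n i" if n: "N \<le> n" "n \<le> N + 4" "offset k n \<le> 2 * golden - 3" for n
  proof -
    have off: "offset i n \<le> 2 * golden - 3"
      using n(3) by (simp add: offset_def i_def)
    have pos: "slope i > 0" "slope (i + 1) > 0"
      using i(1) by (auto intro: slope_pos)
    have "real N * slope i \<le> real n * slope i"
      using pos n by (intro mult_right_mono) auto
    then have "offset i n < n * slope i"
      using off i(2) by linarith
    moreover have "real n * slope (i + 1) \<le> (real N + 4) * slope (i + 1)"
      using pos n by (intro mult_right_mono) auto
    then have "real n * slope (i + 1) \<le> real N * slope (i + 1) + 4 * slope (i + 1)"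
      by (simp add: distrib_right)
    moreover have "slope (i + 1) \<le> slope 5"
      using i(1) by (intro slope_antimono) auto
    moreover have "real N * slope (i + 1) \<le> 5 / 3 * (2 - golden)"
      using i by (intro slope_at_next) auto
    ultimately show ?thesis
      using i(1) off golden_bounds by (simp add: turn_iff slope_numeral)
  qed
  then show ?thesis
    using that[of i] by (simp add: i_def)
qed

lemma frac_window_low:
  fixes N :: nat
  assumes "N \<ge> 1"
  obtains n where "N \<le> n" "n \<le> N + 4" "frac (golden * n) \<le> 2 * golden - 3"
proof -
  define t where "t = frac (golden * N)"
  have t: "0 < t" "t < 1"
    using frac_golden[OF assms] by (simp_all add: t_def)
  note shift = frac_golden_shift[where n = N, folded t_def]
  \<comment> \<open>These arcs are carried into the target arc of length
    \<open>2 * golden - 3\<close> by 0, 3, 1, 4 and 2 steps, and together they cover all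
    \<open>t\<close>.\<close>
  consider "t \<le> 2 * golden - 3" | "5 - 3 * golden \<le> t" "t \<le> 2 - golden"
    | "2 - golden \<le> t" "t \<le> golden - 1" | "7 - 4 * golden \<le> t" "t \<le> 4 - 2 * golden"
    | "4 - 2 * golden \<le> t"
    using golden_bounds by linarith
  then show ?thesis
  proof cases
    case 1
    then show ?thesis
      using that[of N] by (simp add: t_def)
  next
    case 2
    have "frac (golden * real (N + 3)) = t + (golden * 3 - of_int 5)"
      using 2 t golden_bounds by (intro shift) auto
    then show ?thesis
      using that[of "N + 3"] 2 by simp
  next
    case 3
    have "frac (golden * real (N + 1)) = t + (golden * 1 - of_int 2)"
      using 3 t golden_bounds by (intro shift) auto
    then show ?thesis
      using that[of "N + 1"] 3 by simp
  next
    case 4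
    have "frac (golden * real (N + 4)) = t + (golden * 4 - of_int 7)"
      using 4 t golden_bounds by (intro shift) auto
    then show ?thesis
      using that[of "N + 4"] 4 golden_bounds by simp
  next
    case 5
    have "frac (golden * real (N + 2)) = t + (golden * 2 - of_int 4)"
      using 5 t golden_bounds by (intro shift) auto
    then show ?thesis
      using that[of "N + 2"] 5 t golden_bounds by simp
  qed
qed

lemma frac_window_high:
  fixes N :: nat
  assumes "N \<ge> 1"
  obtains n where "N \<le> n" "n \<le> N + 4" "1 - frac (golden * n) \<le> 2 * golden - 3"
proof -
  define t where "t = frac (golden * N)"
  have t: "0 < t" "t < 1"
    using frac_golden[OF assms] by (simp_all add: t_def)
  note shift = frac_golden_shift[where n = N, folded t_def]
  \<comment> \<open>Now the target arc ends at 1, and the cases need 0, 1, 2, 3 and 4 steps.\<close>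
  consider "4 - 2 * golden \<le> t" | "5 - 3 * golden \<le> t" "t < 2 - golden"
    | "7 - 4 * golden \<le> t" "t < 4 - 2 * golden" | "t < 5 - 3 * golden"
    | "2 - golden \<le> t" "t < 7 - 4 * golden"
    using golden_bounds by linarith
  then show ?thesis
  proof cases
    case 1
    then show ?thesis
      using that[of N] by (simp add: t_def)
  next
    case 2
    have "frac (golden * real (N + 1)) = t + (golden * 1 - of_int 1)"
      using 2 t golden_bounds by (intro shift) auto
    then show ?thesis
      using that[of "N + 1"] 2 by simp
  next
    case 3
    have "frac (golden * real (N + 2)) = t + (golden * 2 - of_int 3)"
      using 3 t golden_bounds by (intro shift) auto
    then show ?thesis
      using that[of "N + 2"] 3 by simp
  next
    case 4
    have "frac (golden * real (N + 3)) = t + (golden * 3 - of_int 4)"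
      using 4 t golden_bounds by (intro shift) auto
    then show ?thesis
      using that[of "N + 3"] 4 t golden_bounds by simp
  next
    case 5
    have "frac (golden * real (N + 4)) = t + (golden * 4 - of_int 6)"
      using 5 t golden_bounds by (intro shift) auto
    then show ?thesis
      using that[of "N + 4"] 5 golden_bounds by simp
  qed
qed

lemma down_window:
  assumes "N \<ge> 2"
  shows "\<exists>n\<in>{N..N + 4}. n \<in> down_integers"
proof (cases "N \<ge> 14")
  case True
  \<comment> \<open>14 is the least multiple of \<open>slope 5\<close> above
    \<open>2 * golden - 3\<close>; smaller \<open>N\<close> use explicit members.\<close>
  have "14 * slope 5 \<le> N * slope 5"
    using True slope_pos[of 5] by (intro mult_right_mono) auto
  then have "real N * slope 5 > 2 * golden - 3"
    using golden_bounds by (simp add: slope_numeral)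
  then obtain i where i: "even i = even (5::nat)"
      "\<And>n. N \<le> n \<Longrightarrow> n \<le> N + 4 \<Longrightarrow> offset 5 n \<le> 2 * golden - 3 \<Longrightarrow> turn n i"
    using turn_window[of 5 N] by auto
  obtain n where n: "N \<le> n" "n \<le> N + 4" "frac (golden * n) \<le> 2 * golden - 3"
    using frac_window_low[of N] assms by auto
  then have "turn n i"
    using i(2) by (simp add: offset_def)
  then show ?thesis
    using turn_down_up(1)[of n i] i(1) n assms by auto
next
  case False
  have *: "5 \<in> down_integers" "9 \<in> down_integers" "13 \<in> down_integers"
    using down_up_of_integers(1)[of 5 8 3] down_up_of_integers(1)[of 9 14 3]
      down_up_of_integers(1)[of 13 21 5] golden_bounds by (simp_all add: fib_values)
  consider "N \<le> 5" | "5 < N" "N \<le> 9" | "9 < N" "N \<le> 13"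
    using False by linarith
  then show ?thesis
  proof cases
    case 1
    then show ?thesis
      using *(1) assms by (intro bexI[of _ 5]) auto
  next
    case 2
    then show ?thesis
      using *(2) by (intro bexI[of _ 9]) auto
  next
    case 3
    then show ?thesis
      using *(3) by (intro bexI[of _ 13]) auto
  qed
qed

lemma up_window:
  assumes "N \<ge> 2"
  shows "\<exists>n\<in>{N..N + 4}. n \<in> up_integers"
proof (cases "N \<ge> 5")
  case True
  have "5 * slope 4 \<le> N * slope 4"
    using True slope_pos[of 4] by (intro mult_right_mono) auto
  then have "real N * slope 4 > 2 * golden - 3"
    using golden_bounds by (simp add: slope_numeral)
  then obtain i where i: "even i = even (4::nat)"
      "\<And>n. N \<le> n \<Longrightarrow> n \<le> N + 4 \<Longrightarrow> offset 4 n \<le> 2 * golden - 3 \<Longrightarrow> turn n i"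
    using turn_window[of 4 N] by auto
  obtain n where n: "N \<le> n" "n \<le> N + 4" "1 - frac (golden * n) \<le> 2 * golden - 3"
    using frac_window_high[of N] assms by auto
  then have "turn n i"
    using i(2) by (simp add: offset_def)
  then show ?thesis
    using turn_down_up(2)[of n i] i(1) n assms by auto
next
  case False
  moreover have "6 \<in> up_integers"
    using down_up_of_integers(2)[of 6 9 2] golden_bounds by (simp add: fib_values)
  ultimately show ?thesis
    using assms by (intro bexI[of _ 6]) auto
qed

section \<open>Gap sets and explicit witnesses\<close>

text \<open>The successor of an enumerated element is the least larger member, so consecutive terms
  are the pairs of members with no member between.\<close>

lemma enumerate_gaps:
  fixes S :: "nat set"
  assumes S: "infinite S"
  shows "{int (enumerate S k) - int (enumerate S (k - 1)) | k. k \<ge> 1} =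
    {int g | g. g \<ge> 1 \<and> (\<exists>n\<in>S. n + g \<in> S \<and> (\<forall>m. n < m \<and> m < n + g \<longrightarrow> m \<notin> S))}" (is "?L = ?R")
proof (intro equalityI subsetI)
  fix x assume "x \<in> ?L"
  then obtain k' where k': "k' \<ge> 1" "x = int (enumerate S k') - int (enumerate S (k' - 1))"
    by blast
  define k where "k = k' - 1"
  have x: "x = int (enumerate S (Suc k)) - int (enumerate S k)"
    using k' by (simp add: k_def)
  define n g where "n = enumerate S k" and "g = enumerate S (Suc k) - n"
  have less: "n < enumerate S (Suc k)"
    unfolding n_def by (rule enumerate_step[OF S])
  have "n \<in> S" "n + g \<in> S"
    using enumerate_in_set[OF S] less by (simp_all add: n_def g_def)
  moreover have "m \<notin> S" if "n < m" "m < n + g" for m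
    using that less not_less_Least[of m "\<lambda>s. s \<in> S \<and> enumerate S k < s"]
    unfolding g_def n_def enumerate_Suc''[OF S] by auto
  moreover have "x = int g" "g \<ge> 1"
    using x less by (simp_all add: g_def n_def)
  ultimately show "x \<in> ?R"
    by blast
next
  fix x assume "x \<in> ?R"
  then obtain g n where g: "x = int g" "g \<ge> 1" "n \<in> S" "n + g \<in> S"
      "\<And>m. n < m \<Longrightarrow> m < n + g \<Longrightarrow> m \<notin> S"
    by blast
  obtain k where k: "enumerate S k = n"
    using enumerate_Ex[OF S g(3)] by blast
  have "enumerate S (Suc k) = n + g"
    unfolding enumerate_Suc''[OF S] k
    using g by (intro Least_equality) (auto simp: not_less[symmetric])
  then have "x = int (enumerate S (Suc k)) - int (enumerate S (Suc k - 1))"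
    using g(1) k by simp
  then show "x \<in> ?L"
    by (intro CollectI exI[of _ "Suc k"]) simp
qed

text \<open>Each instance lists \<open>n\<close>, the floor of \<open>golden * n\<close> and an
  index whose parity decides membership. The members provide the gaps (9,10), (5,7), (2,5) and
  (18,23).\<close>

lemma down_values:
  "2 \<in> down_integers" "5 \<in> down_integers" "7 \<in> down_integers" "9 \<in> down_integers" "10 \<in> down_integers" "18 \<in> down_integers" "23 \<in> down_integers"
    "3 \<notin> down_integers" "4 \<notin> down_integers" "6 \<notin> down_integers" "19 \<notin> down_integers" "20 \<notin> down_integers" "21 \<notin> down_integers" "22 \<notin> down_integers"
  using golden_bounds
    down_up_of_integers(1)[of 2 3 1] down_up_of_integers(1)[of 5 8 3]
    down_up_of_integers(1)[of 7 11 3] down_up_of_integers(1)[of 9 14 3]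
    down_up_of_integers(1)[of 10 16 3] down_up_of_integers(1)[of 18 29 5]
    down_up_of_integers(1)[of 23 37 5] down_up_of_integers(1)[of 3 4 2]
    down_up_of_integers(1)[of 4 6 2] down_up_of_integers(1)[of 6 9 2]
    down_up_of_integers(1)[of 19 30 4] down_up_of_integers(1)[of 20 32 4]
    down_up_of_integers(1)[of 21 33 6] down_up_of_integers(1)[of 22 35 4]
  by (simp_all add: fib_values)

lemma up_values:
  "3 \<in> up_integers" "4 \<in> up_integers" "6 \<in> up_integers" "8 \<in> up_integers" "11 \<in> up_integers" "45 \<in> up_integers" "50 \<in> up_integers"
    "5 \<notin> up_integers" "9 \<notin> up_integers" "10 \<notin> up_integers" "46 \<notin> up_integers" "47 \<notin> up_integers" "48 \<notin> up_integers" "49 \<notin> up_integers"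
  using golden_bounds
    down_up_of_integers(2)[of 3 4 2] down_up_of_integers(2)[of 4 6 2]
    down_up_of_integers(2)[of 6 9 2] down_up_of_integers(2)[of 8 12 4]
    down_up_of_integers(2)[of 11 17 4] down_up_of_integers(2)[of 45 72 6]
    down_up_of_integers(2)[of 50 80 6] down_up_of_integers(2)[of 5 8 3]
    down_up_of_integers(2)[of 9 14 3] down_up_of_integers(2)[of 10 16 3]
    down_up_of_integers(2)[of 46 74 5] down_up_of_integers(2)[of 47 76 7]
    down_up_of_integers(2)[of 48 77 5] down_up_of_integers(2)[of 49 79 5]
  by (simp_all add: fib_values)

text \<open>Windows of five numbers give infinitude and, started at \<open>n + 1\<close>, bound the
  gap after \<open>n\<close> by 5; \<open>no_gap_4\<close> removes 4 and \<open>gaps\<close>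
  realizes the rest.\<close>

lemma gap_set_eq:
  assumes ge2: "\<And>n. n \<in> S \<Longrightarrow> n \<ge> 2"
    and window: "\<And>N. N \<ge> 2 \<Longrightarrow> \<exists>n\<in>{N..N + 4}. n \<in> S"
    and no_gap_4: "\<And>n. n \<in> S \<Longrightarrow> n + 4 \<in> S \<Longrightarrow> n + 1 \<in> S \<or> n + 2 \<in> S \<or> n + 3 \<in> S"
    and gaps: "\<And>g. g \<in> {1, 2, 3, 5} \<Longrightarrow> \<exists>n\<in>S. n + g \<in> S \<and> (\<forall>m. n < m \<and> m < n + g \<longrightarrow> m \<notin> S)"
  shows "infinite S"
    and "{int (enumerate S k) - int (enumerate S (k - 1)) | k. k \<ge> 1} = {1, 2, 3, 5}"
proof -
  show inf: "infinite S"
    unfolding infinite_nat_iff_unbounded_le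
  proof
    fix m
    obtain n where "n \<in> {m + 2..m + 2 + 4}" "n \<in> S"
      using window[of "m + 2"] by auto
    then show "\<exists>n\<ge>m. n \<in> S"
      by (intro exI[of _ n]) auto
  qed
  have "g \<in> {1, 2, 3, 5}"
    if g: "g \<ge> 1" "n \<in> S" "n + g \<in> S" "\<forall>m. n < m \<and> m < n + g \<longrightarrow> m \<notin> S" for g n
  proof -
    obtain e where e: "e \<in> {n + 1..n + 1 + 4}" "e \<in> S"
      using window[of "n + 1"] ge2[OF g(2)] by auto
    then have "n < e" "\<not> (n < e \<and> e < n + g)"
      using g(4) by auto
    then have "g \<le> 5"
      using e(1) by simp
    moreover have "g \<noteq> 4"
      using no_gap_4[OF g(2)] g(3,4) by auto
    ultimately show ?thesis
      using g(1) by auto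
  qed
  then have "{int g | g. g \<ge> 1 \<and> (\<exists>n\<in>S. n + g \<in> S \<and> (\<forall>m. n < m \<and> m < n + g \<longrightarrow> m \<notin> S))} =
      {int g | g. g \<in> {1, 2, 3, 5}}"
    using gaps by (intro Collect_cong ex_cong1 conj_cong refl iffI) (blast, fastforce)
  also have "\<dots> = {1, 2, 3, 5}"
    by auto
  finally show "{int (enumerate S k) - int (enumerate S (k - 1)) | k. k \<ge> 1} = {1, 2, 3, 5}"
    unfolding enumerate_gaps[OF inf] .
qed

lemma down_gaps:
  assumes "g \<in> {1, 2, 3, 5}"
  shows "\<exists>n\<in>down_integers. n + g \<in> down_integers \<and>
    (\<forall>m. n < m \<and> m < n + g \<longrightarrow> m \<notin> down_integers)"
proof -
  consider "g = 1" | "g = 2" | "g = 3" | "g = 5"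
    using assms by auto
  then show ?thesis
  proof cases
    case 1
    then show ?thesis
      using down_values by (intro bexI[of _ 9]) auto
  next
    case 2
    have mid: "m = 6" if "5 < m" "m < 7" for m :: nat
      using that by linarith
    show ?thesis
      using 2 down_values by (intro bexI[of _ 5]) (auto dest: mid)
  next
    case 3
    have "m = 3 \<or> m = 4" if "2 < m" "m < 5" for m :: nat
      using that by linarith
    then show ?thesis
      using 3 down_values by (intro bexI[of _ 2]) auto
  next
    case 4
    have "m = 19 \<or> m = 20 \<or> m = 21 \<or> m = 22" if "18 < m" "m < 23" for m :: nat
      using that by linarith
    then show ?thesis
      using 4 down_values by (intro bexI[of _ 18]) auto
  qed
qed

lemma up_gaps:
  assumes "g \<in> {1, 2, 3, 5}"
  shows "\<exists>n\<in>up_integers. n + g \<in> up_integers \<and>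
    (\<forall>m. n < m \<and> m < n + g \<longrightarrow> m \<notin> up_integers)"
proof -
  consider "g = 1" | "g = 2" | "g = 3" | "g = 5"
    using assms by auto
  then show ?thesis
  proof cases
    case 1
    then show ?thesis
      using up_values by (intro bexI[of _ 3]) auto
  next
    case 2
    have mid: "m = 5" if "4 < m" "m < 6" for m :: nat
      using that by linarith
    show ?thesis
      using 2 up_values by (intro bexI[of _ 4]) (auto dest: mid)
  next
    case 3
    have "m = 9 \<or> m = 10" if "8 < m" "m < 11" for m :: nat
      using that by linarith
    then show ?thesis
      using 3 up_values by (intro bexI[of _ 8]) auto
  next
    case 4
    have "m = 46 \<or> m = 47 \<or> m = 48 \<or> m = 49" if "45 < m" "m < 50" for m :: nat
      using that by linarith
    then show ?thesis
      using 4 up_values by (intro bexI[of _ 45]) auto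
  qed
qed

theorem theorem6:
  shows "infinite down_integers \<and> infinite up_integers \<and>
    {int (down_seq (k + 1)) - int (down_seq k) | k. k \<ge> 1} = {1, 2, 3, 5} \<and>
    {int (up_seq (k + 1)) - int (up_seq k) | k. k \<ge> 1} = {1, 2, 3, 5}"
proof -
  have "n \<ge> 2" if "n \<in> down_integers" for n
    using that by (simp add: down_integers_def)
  note down = gap_set_eq[OF this down_window no_gap_4_down down_gaps]
  have "n \<ge> 2" if "n \<in> up_integers" for n
    using that by (simp add: up_integers_def)
  note up = gap_set_eq[OF this up_window no_gap_4_up up_gaps]
  \<comment> \<open>Sequence index \<open>k\<close> is enumeration index \<open>k - 1\<close>, which
    matches the shift in \<open>gap_set_eq\<close>.\<close>
  show ?thesis
    using down up by (simp add: down_seq_def up_seq_def)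
qed

end
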